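(* Let $\mathbb{K}\in\{\mathbb{R},\mathbb{C}\}$. Let $X$ be a compact Hausdorff space, and suppose that $X$ is the topological sum $X=X_1+X_2$, with $\mathcal{N}=\{\mathbf{1},\mathbf{2},\mathbf{3},\dots\}$ being a dense subset of $X_2$, where the points $\mathbf{n}$ are pairwise distinct and isolated in $X$. Suppose also that $\phi:X\setminus\{\mathbf{1}\}\to X$ is a surjective homeomorphism with $\phi(\mathbf{n+1})=\mathbf{n}$ for every $n\in\mathbb{N}$. Let $T:C(X)\to C(X)$ be a codimension $1$ linear isometry (i.e. a linear isometry whose range has codimension $1$) such that $(Tf)(x)=f(\phi(x))$ for every $f\in C(X)$ and $x\in X\setminus\{\mathbf{1}\}$. Then $T$ is not an isometric shift.
   Context: For compact Hausdorff $X$, $C(X)$ is the Banach space of $\mathbb{K}$-valued continuous functions on $X$ with the supremum norm. The topological sum $X_1+X_2$ is the disjoint union of $X_1$ and $X_2$, in which each of them is open and closed. A linear operator $T:E\to E$ on a Banach space $E$ is an isometric shift if $T$ is an isometry, $T(E)$ has codimension $1$ in $E$, and $\bigcap_{n=1}^{\infty}T^n(E)=\{0\}$.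
   Formalization: The summand X_1 is required to be nonempty; with X_1 empty the claim fails, e.g. for X = N ∪ {∞} and the unilateral shift with (Tf)(1) = 0, which is an isometric shift. *)

theory Defs
  imports "HOL-Analysis.Analysis"
begin

text \<open>
  For a compact space \<open>'a\<close>, the type \<open>'a \<Rightarrow>\<^sub>C 'k\<close> of bounded continuous functions
  with its library supremum norm is \<open>C(X)\<close>. The library provides only its real scalar
  multiplication, so multiplication by scalars from \<open>'k\<close> is added here.
\<close>

definition scale_bcontfun ::
    "'k::real_normed_field \<Rightarrow> ('a::topological_space \<Rightarrow>\<^sub>C 'k) \<Rightarrow> ('a \<Rightarrow>\<^sub>C 'k)"
  where "scale_bcontfun c f = Bcontfun (\<lambda>x. c * apply_bcontfun f x)"

lemma apply_scale_bcontfun [simp]: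
  "apply_bcontfun (scale_bcontfun c f) x = c * apply_bcontfun f x"
proof -
  have "bounded ((\<lambda>y. c * y) ` range (apply_bcontfun f))"
    by (intro bounded_linear_image bounded_linear_mult_right bounded_apply_bcontfun)
  then have "(\<lambda>x. c * apply_bcontfun f x) \<in> bcontfun"
    by (auto simp: bcontfun_def image_image intro!: continuous_intros)
  then show ?thesis
    by (simp add: scale_bcontfun_def Bcontfun_inverse)
qed

lemma vector_space_scale_bcontfun: "vector_space scale_bcontfun"
  by unfold_locales (auto intro!: bcontfun_eqI simp: algebra_simps)

lemma scale_bcontfun_real: "scale_bcontfun c f = c *\<^sub>R f"
  by (auto intro!: bcontfun_eqI)

text \<open>
  In the following definitions the scalar multiplication \<open>smul\<close> is a parameter, so that
  they apply over both the real and the complex field. The predicate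
  \<^const>\<open>Vector_Spaces.linear\<close> includes that \<open>smul\<close> makes the type a vector space.
\<close>

definition linear_isometry ::
    "('k::field \<Rightarrow> 'e::real_normed_vector \<Rightarrow> 'e) \<Rightarrow> ('e \<Rightarrow> 'e) \<Rightarrow> bool"
  where "linear_isometry smul T \<longleftrightarrow>
    Vector_Spaces.linear smul smul T \<and> (\<forall>f g. dist (T f) (T g) = dist f g)"

text \<open>
  Finite codimension: \<open>V\<close> has an algebraic complement with a basis \<open>B\<close> of \<open>n\<close> elements,
  equivalently the quotient by \<open>V\<close> has dimension \<open>n\<close>.
\<close>

definition has_codimension ::
    "('k::field \<Rightarrow> 'e::ab_group_add \<Rightarrow> 'e) \<Rightarrow> 'e set \<Rightarrow> nat \<Rightarrow> bool"
  where "has_codimension smul V n \<longleftrightarrow>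
    module.subspace smul V \<and>
    (\<exists>B. finite B \<and> card B = n \<and> \<not> module.dependent smul B \<and>
         V \<inter> module.span smul B = {0} \<and>
         {v + w | v w. v \<in> V \<and> w \<in> module.span smul B} = UNIV)"

definition isometric_shift ::
    "('k::field \<Rightarrow> 'e::real_normed_vector \<Rightarrow> 'e) \<Rightarrow> ('e \<Rightarrow> 'e) \<Rightarrow> bool"
  where "isometric_shift smul T \<longleftrightarrow>
    linear_isometry smul T \<and>
    has_codimension smul (range T) 1 \<and>
    (\<Inter>n\<in>{1..}. range (T ^^ n)) = {0}"

end

theory Submission
  imports Defs
begin

text \<open>
  Since \<open>\<phi>\<close> maps \<open>X1\<close> to \<open>X1\<close> and \<open>X2 - {pt 1}\<close> to \<open>X2\<close>, a function that is constant \<open>\<alpha>\<close> on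
  \<open>X1\<close> and constant \<open>\<beta>\<close> on \<open>X2\<close> satisfies \<open>T f = f\<close> away from \<open>pt 1\<close>. The remaining condition
  \<open>(T f) (pt 1) = \<beta>\<close> is a single homogeneous linear equation in \<open>(\<alpha>, \<beta>)\<close>, so it has a nontrivial
  solution, and a nonzero fixed point of \<open>T\<close> lies in the range of every \<open>T ^^ n\<close>.
\<close>

lemma fixed_point_not_isometric_shift:
  assumes "T f = f" and "f \<noteq> 0"
  shows "\<not> isometric_shift smul T"
proof -
  have "(T ^^ n) f = f" for n
    by (induction n) (simp_all add: assms(1))
  then have "f \<in> (\<Inter>n\<in>{1..}. range (T ^^ n))"
    by (metis INT_I rangeI)
  with assms(2) show ?thesis
    by (auto simp: isometric_shift_def)
qed

lemma clopen_indicator_bcontfun: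
  fixes A :: "'a::topological_space set"
  assumes "open A" and "open (- A)"
  shows "(\<lambda>x. of_bool (x \<in> A) :: 'k::real_normed_field) \<in> bcontfun"
proof -
  \<comment> \<open>Both \<open>A\<close> and \<open>- A\<close> are closed as well, so the
    constants 1 and 0 glue along them.\<close>
  have "continuous_on UNIV (\<lambda>x. if x \<in> A then 1 else 0 :: 'k)"
    using continuous_on_cases[of A "- A" "\<lambda>_. 1 :: 'k" "\<lambda>_. 0" "\<lambda>x. x \<in> A"] assms
    by (simp add: closed_def)
  then have "continuous_on UNIV (\<lambda>x. of_bool (x \<in> A) :: 'k)"
    by (simp add: of_bool_def)
  moreover have "bounded (range (\<lambda>x. of_bool (x \<in> A) :: 'k))"
    by (rule finite_imp_bounded, rule finite_subset[of _ "{0, 1}"]) auto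
  ultimately show ?thesis
    by (simp add: bcontfun_def)
qed

lemma composition_operator_fixed_point:
  fixes T :: "('a::topological_space \<Rightarrow>\<^sub>C 'k::real_normed_field) \<Rightarrow> ('a \<Rightarrow>\<^sub>C 'k)"
  assumes lin: "Vector_Spaces.linear scale_bcontfun scale_bcontfun T"
    and comp: "\<And>f x. x \<noteq> p \<Longrightarrow> apply_bcontfun (T f) x = apply_bcontfun f (\<phi> x)"
    and A: "open A" "open (- A)" "A \<noteq> {}" "p \<notin> A"
    and inv: "\<And>x. x \<noteq> p \<Longrightarrow> \<phi> x \<in> A \<longleftrightarrow> x \<in> A"
  shows "\<exists>f. f \<noteq> 0 \<and> T f = f"
proof -
  interpret Vector_Spaces.linear scale_bcontfun scale_bcontfun T by (rule lin)
  define u :: "'a \<Rightarrow>\<^sub>C 'k" where "u = Bcontfun (\<lambda>x. of_bool (x \<in> A))"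
  define v :: "'a \<Rightarrow>\<^sub>C 'k" where "v = Bcontfun (\<lambda>x. of_bool (x \<in> - A))"
  have u: "apply_bcontfun u x = of_bool (x \<in> A)" for x
    unfolding u_def using clopen_indicator_bcontfun[of A] A
    by (subst Bcontfun_inverse) simp_all
  have v: "apply_bcontfun v x = of_bool (x \<in> - A)" for x
    unfolding v_def using clopen_indicator_bcontfun[of "- A"] A
    by (subst Bcontfun_inverse) simp_all
  define a where "a = apply_bcontfun (T u) p"
  define b where "b = apply_bcontfun (T v) p"
  \<comment> \<open>The equation is the fixed-point condition at \<open>p\<close> for
    \<open>f\<close> below. If \<open>a = 0\<close>, the indicator \<open>u\<close> alone solves it;
    otherwise fix \<beta> = 1 and divide by \<open>a\<close>.\<close>
  obtain \<alpha> \<beta> where eq: "\<alpha> * a + \<beta> * b = \<beta>" and nz: "\<alpha> \<noteq> 0 \<or> \<beta> \<noteq> 0"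
  proof (cases "a = 0")
    case True
    then show thesis using that[of 1 0] by simp
  next
    case False
    then show thesis using that[of "(1 - b) / a" 1] by simp
  qed
  define f where "f = scale_bcontfun \<alpha> u + scale_bcontfun \<beta> v"
  have f: "apply_bcontfun f x = (if x \<in> A then \<alpha> else \<beta>)" for x
    by (simp add: f_def u v)
  have "apply_bcontfun (T f) p = \<beta>"
    using eq by (simp add: f_def add scale a_def b_def)
  \<comment> \<open>At \<open>p\<close> both sides are \<beta>, because \<open>p\<close> lies
    outside \<open>A\<close>. Elsewhere \<open>inv\<close> puts \<open>x\<close> and its image under
    \<phi> on the same side of the partition.\<close>
  then have "apply_bcontfun (T f) x = apply_bcontfun f x" for x
    using A(4) by (cases "x = p") (simp_all add: f comp inv)
  then have "T f = f"
    by (rule bcontfun_eqI)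
  moreover have "f \<noteq> 0"
  proof
    assume "f = 0"
    then have "(if x \<in> A then \<alpha> else \<beta>) = 0" for x
      using f[of x] by simp
    \<comment> \<open>Both values of \<open>f\<close> are attained: \<alpha> because
      \<open>A\<close> is nonempty, \<beta> at \<open>p\<close>. So both would vanish.\<close>
    with A(3,4) nz show False
      by (metis ex_in_conv)
  qed
  ultimately show ?thesis by blast
qed

theorem proposition9p1:
  fixes X1 X2 :: "'a::t2_space set"
    and pt :: "nat \<Rightarrow> 'a"
    and \<phi> :: "'a \<Rightarrow> 'a"
  assumes "compact (UNIV :: 'a set)"
    and "open X1" and "open X2" and "X1 \<inter> X2 = {}" and "X1 \<union> X2 = UNIV"
    and "X1 \<noteq> {}"
    and "inj_on pt {1..}"
    and "\<forall>n\<ge>1. pt n isolated_in UNIV"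
    and "pt ` {1..} \<subseteq> X2" and "X2 \<subseteq> closure (pt ` {1..})"
    and "\<exists>\<psi>. homeomorphism (UNIV - {pt 1}) UNIV \<phi> \<psi>"
    and "\<forall>n\<ge>1. \<phi> (pt (n + 1)) = pt n"
  shows "(\<forall>T :: ('a \<Rightarrow>\<^sub>C real) \<Rightarrow> ('a \<Rightarrow>\<^sub>C real).
            linear_isometry scale_bcontfun T \<and>
            has_codimension scale_bcontfun (range T) 1 \<and>
            (\<forall>f x. x \<noteq> pt 1 \<longrightarrow> apply_bcontfun (T f) x = apply_bcontfun f (\<phi> x))
            \<longrightarrow> \<not> isometric_shift scale_bcontfun T)
       \<and> (\<forall>T :: ('a \<Rightarrow>\<^sub>C complex) \<Rightarrow> ('a \<Rightarrow>\<^sub>C complex).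
            linear_isometry scale_bcontfun T \<and>
            has_codimension scale_bcontfun (range T) 1 \<and>
            (\<forall>f x. x \<noteq> pt 1 \<longrightarrow> apply_bcontfun (T f) x = apply_bcontfun f (\<phi> x))
            \<longrightarrow> \<not> isometric_shift scale_bcontfun T)"
proof -
  let ?N = "pt ` {1..}"
  obtain \<psi> where \<psi>: "homeomorphism (UNIV - {pt 1}) UNIV \<phi> \<psi>"
    using assms(11) by blast
  have X1: "X1 = - X2"
    using assms(4,5) by blast
  have "closed X2"
    using assms(2) X1 by (simp add: closed_def)
  with assms(9,10) have X2: "X2 = closure ?N"
    by (intro equalityI closure_minimal)
  have pt_Suc: "\<phi> (pt (Suc n)) = pt n" if "n \<ge> 1" for n
    using assms(12) that by simp
  have \<psi>_pt: "\<psi> (pt n) = pt (Suc n)" if "n \<ge> 1" for n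
  proof -
    \<comment> \<open>This puts \<open>pt (Suc n)\<close> in the domain of \<phi>, where \<psi>
      inverts it.\<close>
    have "pt (Suc n) \<noteq> pt 1"
      using inj_onD[OF assms(7), of "Suc n" 1] that by auto
    then show ?thesis
      using homeomorphism_apply1[OF \<psi>, of "pt (Suc n)"] pt_Suc[OF that] by simp
  qed
  \<comment> \<open>If \<phi> sent \<open>x\<close> into \<open>X1\<close>, it would send a whole
    neighbourhood \<open>U\<close> of \<open>x\<close> there. By density \<open>U\<close> contains
    some \<open>pt n\<close>, and \<open>n > 1\<close> because \<open>U\<close> omits
    \<open>pt 1\<close>; but \<phi> maps that point to its predecessor, which is in
    \<open>X2\<close>.\<close>
  have fwd: "\<phi> x \<in> X2" if "x \<in> X2" "x \<noteq> pt 1" for x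
  proof (rule ccontr)
    assume "\<phi> x \<notin> X2"
    define U where "U = \<phi> -` X1 \<inter> (UNIV - {pt 1})"
    have "open U"
      using continuous_on_open_vimage[of "UNIV - {pt 1}" \<phi>] homeomorphism_cont1[OF \<psi>] assms(2)
      by (simp add: U_def open_Diff)
    moreover have "x \<in> U"
      using \<open>\<phi> x \<notin> X2\<close> that(2) X1 by (simp add: U_def)
    ultimately have "U \<inter> ?N \<noteq> {}"
      using that(1) X2 open_Int_closure_eq_empty[of U ?N] by blast
    then obtain n where n: "n \<ge> 1" "pt n \<in> U"
      by auto
    then have "n \<noteq> 1"
      by (auto simp: U_def)
    with n(1) obtain m where m: "n = Suc m" "m \<ge> 1"
      by (cases n) auto
    with n(2) have "pt m \<in> X1"
      by (simp add: U_def pt_Suc)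
    with m(2) assms(9) X1 show False
      by auto
  qed
  \<comment> \<open>Unlike \<phi>, the inverse \<psi> is continuous on the whole space, so the
    inclusion passes directly from the dense sequence to its closure \<open>X2\<close>.\<close>
  have bwd: "x \<in> X2" if "\<phi> x \<in> X2" "x \<noteq> pt 1" for x
  proof -
    have "\<psi> ` ?N \<subseteq> X2"
      using \<psi>_pt assms(9) by auto
    then have "\<psi> ` closure ?N \<subseteq> X2"
      using homeomorphism_cont2[OF \<psi>] X2
      by (intro image_closure_subset) (auto intro: continuous_on_subset)
    moreover have "\<psi> (\<phi> x) = x"
      using homeomorphism_apply1[OF \<psi>] that(2) by simp
    ultimately show ?thesis
      using that(1) X2 by force
  qed
  have inv: "\<phi> x \<in> X1 \<longleftrightarrow> x \<in> X1" if "x \<noteq> pt 1" for x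
    using fwd bwd that X1 by blast
  have X1c: "open (- X1)" "pt 1 \<notin> X1"
    using assms(3,9) X1 by auto
  \<comment> \<open>The scalar type stays a variable here, so that this one fact serves both the
    real and the complex conjunct.\<close>
  have fix_ex: "\<exists>f. f \<noteq> 0 \<and> T f = f"
    if "linear_isometry scale_bcontfun T"
      and "\<forall>f x. x \<noteq> pt 1 \<longrightarrow> apply_bcontfun (T f) x = apply_bcontfun f (\<phi> x)"
    for T :: "('a \<Rightarrow>\<^sub>C 'k::real_normed_field) \<Rightarrow> ('a \<Rightarrow>\<^sub>C 'k)"
  proof (rule composition_operator_fixed_point[of T "pt 1" \<phi> X1])
    show "Vector_Spaces.linear scale_bcontfun scale_bcontfun T"
      using that(1) by (simp add: linear_isometry_def)
  qed (use that(2) assms(2,6) X1c inv in auto)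
  show ?thesis
    by (intro conjI allI impI; elim conjE;
        drule (1) fix_ex; elim exE conjE; rule fixed_point_not_isometric_shift)
qed

end
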